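(* Consider a large-$N$ family of four-dimensional $\mathcal N=2$ quiver SCFTs with bifundamental matter, with quiver shape given by a finite Lie algebra $\mathfrak b$ (see context). Then, at leading order in the large-$N$ limit, the exponential rate associated with decoupling node $i$ is $$\kappa_i=\kappa_{\min}\sqrt{\frac{n_{\rm V}}{\dim\mathfrak g_i}},\qquad \kappa_{\min}\ \le\ \sqrt{\frac12+\frac1{12}R^{\max}_{\mathfrak b}}\ <\ \sqrt{\frac12+\frac1{3h^\vee_{\mathfrak b}}},\qquad R^{\max}_{\mathfrak b}=\max_{i,j}\frac{(C^{-1})_{ij}}{(C^{-2})_{ij}},$$ where $C$ is the Cartan matrix and $h^\vee_{\mathfrak b}$ the dual Coxeter number of $\mathfrak b$.
   Context: **Quiver data.** $\mathfrak b$ is a simple Lie algebra of type $A_r,B_r,C_r,D_r,E_6,E_7,E_8$ or $F_4$. Nodes $i$ of its Dynkin diagram carry simple gauge algebras $\mathfrak g_i\in\{\mathfrak{su}(k_i),\mathfrak{so}(k_i),\mathfrak{usp}(k_i)\}$ (with $k_i$ the dimension of the fundamental representation) and flavour algebras with fundamental representation of dimension $f^i\ge0$. Set $S^i=0,-1,+1$ and $d_i=2,1,1$ for $\mathfrak g_i=\mathfrak{su},\mathfrak{so},\mathfrak{usp}$ respectively. If $\mathfrak b$ is simply laced, either all nodes are $\mathfrak{su}$, or all nodes are $\mathfrak{so}/\mathfrak{usp}$ with adjacent nodes of opposite type. If $\mathfrak b$ is not simply laced, nodes for long roots have $d_i=1$ (adjacent ones of opposite type) and nodes for short roots have $d_i=2$.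 Let $D=\mathrm{diag}(d_i)$, $C$ the Cartan matrix of $\mathfrak b$ in the convention where $DC$ is symmetric, $A=2\cdot\mathbf 1-C$, $B=DA$. Conformality is the condition $C^{ij}k_j=f^i-4S^i$ with $k_i>0$, $f^i\ge0$ integers. A large-$N$ family is a sequence of solutions (with fixed $\mathfrak b$ and $S$) with $k_i\propto N$ for all $i$ as $N\to\infty$. **Multiplet numbers, central charge, rates.** The numbers of vector multiplets and full hypermultiplets are $n_{\rm V}=\sum_i\dim\mathfrak g_i$, where $\dim\mathfrak{su}(k)=k^2-1$, $\dim\mathfrak{so}(k)=\frac12k(k-1)$, $\dim\mathfrak{usp}(k)=\frac12k(k+1)$, and $n_{\rm H}=\frac14\sum_{i,j}B^{ij}k_ik_j+\frac12\sum_id_ik_if^i$. The central charge is $c=\frac1{24}(4n_{\rm V}+2n_{\rm H})$. The rates are $\kappa_i=\sqrt{2c/\dim\mathfrak g_i}$ and $\kappa_{\min}=\sqrt{2c/n_{\rm V}}$. In flat coordinates $\hat g_i$ on the conformal manifold at weak coupling, the gauge coupling of node $i$ behaves as $g_i\sim e^{-\kappa_i\hat g_i}$.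
   Formalization: The strict inequality is claimed only for 𝔟 ≠ A_1: for A_1 (a single node, no bifundamental matter) C=(2), R^max=2=4/h^∨, so the two square roots are equal; the rate formula and the bound on κ_min still cover A_1. *)

theory Defs
  imports Complex_Main "Jordan_Normal_Form.Gauss_Jordan_Elimination"
begin

text \<open>Nodes of the Dynkin diagram of a Lie algebra of rank \<open>r\<close> are numbered \<open>0, \<dots>, r - 1\<close>:
  Bourbaki's numbering shifted by one.\<close>

datatype dynkin =
    TypeA nat | TypeB nat | TypeC nat | TypeD nat | TypeE6 | TypeE7 | TypeE8 | TypeF4

text \<open>The bounds exclude non-simple and undefined cases; the low-rank coincidences
  \<open>B\<^sub>2 = C\<^sub>2\<close> and \<open>D\<^sub>3 = A\<^sub>3\<close> are kept.\<close>

fun simple_type :: "dynkin \<Rightarrow> bool" where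
  "simple_type (TypeA r) = (1 \<le> r)"
| "simple_type (TypeB r) = (2 \<le> r)"
| "simple_type (TypeC r) = (2 \<le> r)"
| "simple_type (TypeD r) = (3 \<le> r)"
| "simple_type _ = True"

fun rank :: "dynkin \<Rightarrow> nat" where
  "rank (TypeA r) = r"
| "rank (TypeB r) = r"
| "rank (TypeC r) = r"
| "rank (TypeD r) = r"
| "rank TypeE6 = 6"
| "rank TypeE7 = 7"
| "rank TypeE8 = 8"
| "rank TypeF4 = 4"

fun dual_coxeter :: "dynkin \<Rightarrow> nat" where
  "dual_coxeter (TypeA r) = r + 1"
| "dual_coxeter (TypeB r) = 2 * r - 1"
| "dual_coxeter (TypeC r) = r + 1"
| "dual_coxeter (TypeD r) = 2 * r - 2"
| "dual_coxeter TypeE6 = 12"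
| "dual_coxeter TypeE7 = 18"
| "dual_coxeter TypeE8 = 30"
| "dual_coxeter TypeF4 = 9"

fun simply_laced :: "dynkin \<Rightarrow> bool" where
  "simply_laced (TypeB r) = False"
| "simply_laced (TypeC r) = False"
| "simply_laced TypeF4 = False"
| "simply_laced _ = True"

text \<open>In the simply laced case all simple roots count as long; only the distinction
  between the two lengths matters for the Cartan matrix.\<close>

fun long_root :: "dynkin \<Rightarrow> nat \<Rightarrow> bool" where
  "long_root (TypeB r) i = (Suc i < r)"
| "long_root (TypeC r) i = (Suc i = r)"
| "long_root TypeF4 i = (i < 2)"
| "long_root _ i = True"

text \<open>Links between nodes \<open>i < j\<close>, irrespective of their multiplicity. In type \<open>E\<close>, node \<open>1\<close> is
  the end of the short leg and \<open>3\<close> is the trivalent node.\<close>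

fun link :: "dynkin \<Rightarrow> nat \<Rightarrow> nat \<Rightarrow> bool" where
  "link (TypeD r) i j = ((j = Suc i \<and> Suc j < r) \<or> (i + 3 = r \<and> Suc j = r))"
| "link TypeE6 i j = ((i, j) \<in> {(0, 2), (1, 3), (2, 3), (3, 4), (4, 5)})"
| "link TypeE7 i j = ((i, j) \<in> {(0, 2), (1, 3), (2, 3), (3, 4), (4, 5), (5, 6)})"
| "link TypeE8 i j = ((i, j) \<in> {(0, 2), (1, 3), (2, 3), (3, 4), (4, 5), (5, 6), (6, 7)})"
| "link b i j = (j = Suc i \<and> j < rank b)"

definition adjacent :: "dynkin \<Rightarrow> nat \<Rightarrow> nat \<Rightarrow> bool" where
  "adjacent b i j \<longleftrightarrow> link b i j \<or> link b j i"

text \<open>The convention is \<open>C\<^sub>i\<^sub>j = 2 (\<alpha>\<^sub>i, \<alpha>\<^sub>j) / (\<alpha>\<^sub>j, \<alpha>\<^sub>j)\<close>, so the entry \<open>-2\<close> sits in the row of a long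
  root. This is the one for which \<open>D C\<close> is symmetric, see \<open>DC_symmetric\<close> below.\<close>

definition cartan :: "dynkin \<Rightarrow> real mat" where
  "cartan b = mat (rank b) (rank b) (\<lambda>(i, j).
     if i = j then 2
     else if adjacent b i j then (if long_root b i \<and> \<not> long_root b j then - 2 else - 1)
     else 0)"

definition cartan_inv :: "dynkin \<Rightarrow> real mat" where
  "cartan_inv b = the (mat_inverse (cartan b))"

definition R_max :: "dynkin \<Rightarrow> real" where
  "R_max b = Max {cartan_inv b $$ (i, j) / (cartan_inv b * cartan_inv b) $$ (i, j) | i j.
     i < rank b \<and> j < rank b}"

datatype gauge = SU | SO | USp

fun d :: "gauge \<Rightarrow> real" where
  "d SU = 2" | "d SO = 1" | "d USp = 1"

fun S :: "gauge \<Rightarrow> real" where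
  "S SU = 0" | "S SO = - 1" | "S USp = 1"

text \<open>Here \<open>k\<close> is the dimension of the fundamental representation.\<close>

fun dim_gauge :: "gauge \<Rightarrow> nat \<Rightarrow> real" where
  "dim_gauge SU k = (real k)\<^sup>2 - 1"
| "dim_gauge SO k = real k * (real k - 1) / 2"
| "dim_gauge USp k = real k * (real k + 1) / 2"

definition gauge_assignment :: "dynkin \<Rightarrow> (nat \<Rightarrow> gauge) \<Rightarrow> bool" where
  "gauge_assignment b g \<longleftrightarrow>
     (if simply_laced b then
        (\<forall>i < rank b. g i = SU) \<or>
        ((\<forall>i < rank b. g i \<in> {SO, USp}) \<and>
         (\<forall>i < rank b. \<forall>j < rank b. adjacent b i j \<longrightarrow> g i \<noteq> g j))
      else
        (\<forall>i < rank b. if long_root b i then g i \<in> {SO, USp} else g i = SU) \<and>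
        (\<forall>i < rank b. \<forall>j < rank b.
           long_root b i \<and> long_root b j \<and> adjacent b i j \<longrightarrow> g i \<noteq> g j))"

definition D_mat :: "dynkin \<Rightarrow> (nat \<Rightarrow> gauge) \<Rightarrow> real mat" where
  "D_mat b g = mat (rank b) (rank b) (\<lambda>(i, j). if i = j then d (g i) else 0)"

definition A_mat :: "dynkin \<Rightarrow> real mat" where
  "A_mat b = 2 \<cdot>\<^sub>m 1\<^sub>m (rank b) - cartan b"

definition B_mat :: "dynkin \<Rightarrow> (nat \<Rightarrow> gauge) \<Rightarrow> real mat" where
  "B_mat b g = D_mat b g * A_mat b"

lemma DC_symmetric:
  assumes "gauge_assignment b g"
  shows "transpose_mat (D_mat b g * cartan b) = D_mat b g * cartan b"
proof -
  let ?r = "rank b"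
  have entry: "(D_mat b g * cartan b) $$ (i, j) = d (g i) * cartan b $$ (i, j)"
    if "i < ?r" "j < ?r" for i j
  proof -
    have "(D_mat b g * cartan b) $$ (i, j)
        = (\<Sum>l\<in>{0..<?r}. (if i = l then d (g i) else 0) * cartan b $$ (l, j))"
      using that by (simp add: D_mat_def cartan_def scalar_prod_def)
    also have "\<dots> = (\<Sum>l\<in>{0..<?r}. if i = l then d (g i) * cartan b $$ (l, j) else 0)"
      by (intro sum.cong) auto
    also have "\<dots> = d (g i) * cartan b $$ (i, j)"
      using that by simp
    finally show ?thesis .
  qed
  have sl: "long_root b i" if "simply_laced b" for i
    using that by (cases b) auto
  have d1: "d x = 1" if "x \<in> {SO, USp}" for x using that by auto
  have sym: "d (g i) * cartan b $$ (i, j) = d (g j) * cartan b $$ (j, i)"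
    if ij: "i < ?r" "j < ?r" for i j
  proof (cases "simply_laced b")
    case True
    then have "(\<forall>i < ?r. g i = SU) \<or> (\<forall>i < ?r. g i \<in> {SO, USp})"
      using assms by (auto simp: gauge_assignment_def)
    then have "d (g i) = d (g j)"
    proof
      assume "\<forall>i < ?r. g i = SU"
      then show ?thesis using ij by simp
    next
      assume "\<forall>i < ?r. g i \<in> {SO, USp}"
      then show ?thesis using ij d1 by metis
    qed
    moreover have "cartan b $$ (i, j) = cartan b $$ (j, i)"
      using ij by (simp add: cartan_def adjacent_def disj_commute sl[OF True])
    ultimately show ?thesis by simp
  next
    case False
    have "\<forall>l < ?r. if long_root b l then g l \<in> {SO, USp} else g l = SU"
      using assms unfolding gauge_assignment_def if_not_P[OF False] by (rule conjunct1)
    then have "d (g l) = (if long_root b l then 1 else 2)" if "l < ?r" for l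
      using that d1[of "g l"] by (auto split: if_splits)
    from this[OF ij(1)] this[OF ij(2)] show ?thesis
      using ij by (simp add: cartan_def adjacent_def disj_commute)
  qed
  show ?thesis
  proof (rule eq_matI)
    have dims: "dim_row (D_mat b g * cartan b) = ?r" "dim_col (D_mat b g * cartan b) = ?r"
      by (simp_all add: D_mat_def cartan_def)
    fix i j assume "i < dim_row (D_mat b g * cartan b)" "j < dim_col (D_mat b g * cartan b)"
    then have ij: "i < ?r" "j < ?r" by (simp_all only: dims)
    then have "transpose_mat (D_mat b g * cartan b) $$ (i, j) = (D_mat b g * cartan b) $$ (j, i)"
      by (intro index_transpose_mat(1)) (simp_all only: dims)
    then show "transpose_mat (D_mat b g * cartan b) $$ (i, j) = (D_mat b g * cartan b) $$ (i, j)"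
      by (simp only: entry[OF ij] entry[OF ij(2,1)] sym[OF ij])
  qed (simp_all add: D_mat_def cartan_def)
qed

text \<open>An algebra \<open>usp(k)\<close> exists for even \<open>k\<close> only.\<close>

definition conformal :: "dynkin \<Rightarrow> (nat \<Rightarrow> gauge) \<Rightarrow> (nat \<Rightarrow> nat) \<Rightarrow> (nat \<Rightarrow> nat) \<Rightarrow> bool" where
  "conformal b g k f \<longleftrightarrow>
     (\<forall>i < rank b.
        k i > 0 \<and> (g i = USp \<longrightarrow> even (k i)) \<and>
        (\<Sum>j < rank b. cartan b $$ (i, j) * real (k j)) = real (f i) - 4 * S (g i))"

text \<open>Member \<open>n\<close> of the family has size parameter \<open>N n\<close>, ranks \<open>k n i\<close> and flavours \<open>f n i\<close>.\<close>

definition large_N_family ::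
    "dynkin \<Rightarrow> (nat \<Rightarrow> gauge) \<Rightarrow> (nat \<Rightarrow> real) \<Rightarrow> (nat \<Rightarrow> nat \<Rightarrow> nat) \<Rightarrow> (nat \<Rightarrow> nat \<Rightarrow> nat) \<Rightarrow> bool"
where
  "large_N_family b g N k f \<longleftrightarrow>
     (\<forall>n. conformal b g (k n) (f n)) \<and>
     filterlim N at_top sequentially \<and>
     (\<forall>i < rank b. \<exists>\<nu> > 0. (\<lambda>n. real (k n i) / N n) \<longlonglongrightarrow> \<nu>)"

definition n_V :: "dynkin \<Rightarrow> (nat \<Rightarrow> gauge) \<Rightarrow> (nat \<Rightarrow> nat) \<Rightarrow> real" where
  "n_V b g k = (\<Sum>i < rank b. dim_gauge (g i) (k i))"

definition n_H :: "dynkin \<Rightarrow> (nat \<Rightarrow> gauge) \<Rightarrow> (nat \<Rightarrow> nat) \<Rightarrow> (nat \<Rightarrow> nat) \<Rightarrow> real" where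
  "n_H b g k f =
     (\<Sum>i < rank b. \<Sum>j < rank b. B_mat b g $$ (i, j) * real (k i) * real (k j)) / 4 +
     (\<Sum>i < rank b. d (g i) * real (k i) * real (f i)) / 2"

definition central_charge ::
    "dynkin \<Rightarrow> (nat \<Rightarrow> gauge) \<Rightarrow> (nat \<Rightarrow> nat) \<Rightarrow> (nat \<Rightarrow> nat) \<Rightarrow> real" where
  "central_charge b g k f = (4 * n_V b g k + 2 * n_H b g k f) / 24"

definition \<kappa> ::
    "dynkin \<Rightarrow> (nat \<Rightarrow> gauge) \<Rightarrow> (nat \<Rightarrow> nat) \<Rightarrow> (nat \<Rightarrow> nat) \<Rightarrow> nat \<Rightarrow> real" where
  "\<kappa> b g k f i = sqrt (2 * central_charge b g k f / dim_gauge (g i) (k i))"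

definition \<kappa>_min ::
    "dynkin \<Rightarrow> (nat \<Rightarrow> gauge) \<Rightarrow> (nat \<Rightarrow> nat) \<Rightarrow> (nat \<Rightarrow> nat) \<Rightarrow> real" where
  "\<kappa>_min b g k f = sqrt (2 * central_charge b g k f / n_V b g k)"

text \<open>For \<open>A\<^sub>1\<close>, a single node without bifundamental matter, the strict inequality
  \<open>R_max b < 4 / dual_coxeter b\<close> degenerates to an equality.\<close>

lemma R_max_A1: "R_max (TypeA 1) = 4 / real (dual_coxeter (TypeA 1))"
proof -
  let ?C = "cartan (TypeA (Suc 0))"
  let ?H = "mat (Suc 0) (Suc 0) (\<lambda>_. 1 / 2) :: real mat"
  have C: "?C = mat (Suc 0) (Suc 0) (\<lambda>_. 2)"
    by (rule eq_matI) (auto simp: cartan_def)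
  have car: "?C \<in> carrier_mat (Suc 0) (Suc 0)" by (simp add: C)
  have CH: "?C * ?H = 1\<^sub>m (Suc 0)" "?H * ?C = 1\<^sub>m (Suc 0)"
    by (rule eq_matI; simp add: C scalar_prod_def)+
  then have "?C \<in> Units (ring_mat TYPE(real) (Suc 0) undefined)"
    using car unfolding Units_def ring_mat_def by (auto intro!: bexI[of _ ?H])
  then obtain M where M: "mat_inverse ?C = Some M"
    using mat_inverse(1)[OF car, of undefined] by (cases "mat_inverse ?C") auto
  then have "M * ?C = 1\<^sub>m (Suc 0)" and Mc: "M \<in> carrier_mat (Suc 0) (Suc 0)"
    using mat_inverse(2)[OF car M] by auto
  then have "(M * ?C) $$ (0, 0) = 1" by simp
  then have M00: "M $$ (0, 0) = 1 / 2"
    using Mc by (simp add: C scalar_prod_def)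
  have "(M * M) $$ (0, 0) = M $$ (0, 0) * M $$ (0, 0)"
    using Mc by (simp add: scalar_prod_def)
  then have MM00: "(M * M) $$ (0, 0) = 1 / 4"
    unfolding M00 by simp
  have "R_max (TypeA (Suc 0)) = Max {M $$ (0, 0) / (M * M) $$ (0, 0)}"
    unfolding R_max_def cartan_inv_def M
    by (rule arg_cong[where f = Max]) auto
  also have "\<dots> = 2" by (simp only: M00 MM00) simp
  finally show ?thesis by simp
qed

end

(* At leading order k = N v with C v = phi >= 0 entrywise, and conformality gives
     kappa_min^2 -> 1/2 + Q / (12 P), where P = v^T D v and Q = v^T D C v. Since D C is symmetric,
     Q = phi^T D C^-1 phi and P = phi^T D C^-2 phi; all entries of C^-1 and C^-2 are positive, so
     comparing them entrywise gives Q <= R_max P. The strict bound h C^-1 < 4 C^-2 (entrywise) is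
     read off explicit formulas for the inverses; in types B_r and C_r it even holds
     for h = 2r, the Coxeter number of the simply laced diagrams D_(r+1) and A_(2r-1) that fold
     to them. *)
theory Submission
  imports Defs "Jordan_Normal_Form.Determinant"
begin

text \<open>\<open>cartan_inv\<close> is given only as \<open>the (mat_inverse ...)\<close>, and
  \<open>R_max\<close> is a maximum over all pairs of nodes, of unbounded rank. Candidate entries H
  and K are therefore supplied by hand and verified through C H = 1 and C K = H alone: the rows of C
  have at most four nonzero entries, whereas the dense product H H would require closed forms of
  sums. In the infinite series C is a discrete second difference, so H is a Green's function,
  piecewise linear in the node, and K is piecewise cubic. The gap h H < 4 K becomes tractable
  because K is H times a polynomial quadratic in the two positions (up to a correction on the spinor
  nodes of type D), which leaves a quadratic inequality for that factor. The constant 4 is what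
  turns \<open>R_max b / 12\<close> into 1/(3h).\<close>

text \<open>\<open>H\<close> and \<open>K\<close> hold the entries of \<open>C\<^sup>-\<^sup>1\<close> and \<open>C\<^sup>-\<^sup>2\<close>.\<close>

definition inverse_certificate ::
    "dynkin \<Rightarrow> (nat \<Rightarrow> nat \<Rightarrow> real) \<Rightarrow> (nat \<Rightarrow> nat \<Rightarrow> real) \<Rightarrow> bool"
where
  "inverse_certificate b H K \<longleftrightarrow>
     (\<forall>i < rank b. \<forall>j < rank b.
        (\<Sum>l < rank b. cartan b $$ (i, l) * H l j) = of_bool (i = j) \<and>
        (\<Sum>l < rank b. cartan b $$ (i, l) * K l j) = H i j \<and>
        0 < H i j)"

section \<open>Certificates and the entries of C^-1 and C^-2\<close>

lemma mat_inverse_eqI: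
  fixes A M :: "real mat"
  assumes A: "A \<in> carrier_mat n n" and M: "M \<in> carrier_mat n n" and AM: "A * M = 1\<^sub>m n"
  shows "mat_inverse A = Some M"
proof -
  have MA: "M * A = 1\<^sub>m n" using mat_mult_left_right_inverse[OF A M AM] .
  have "A \<in> Units (ring_mat TYPE(real) n undefined)"
    using A M AM MA unfolding Units_def ring_mat_def by (auto intro!: bexI[of _ M])
  then obtain M' where M': "mat_inverse A = Some M'"
    using mat_inverse(1)[OF A, of undefined] by (cases "mat_inverse A") auto
  then have M'A: "M' * A = 1\<^sub>m n" and M'c: "M' \<in> carrier_mat n n"
    using mat_inverse(2)[OF A M'] by auto
  have "M' = M' * (A * M)" using M'c by (simp add: AM)
  also have "\<dots> = M" using assoc_mult_mat[OF M'c A M] M'A M by simp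
  finally show ?thesis using M' by simp
qed

lemma cartan_carrier: "cartan b \<in> carrier_mat (rank b) (rank b)"
  by (simp add: cartan_def)

lemma mult_mat_eq:
  assumes "A \<in> carrier_mat n n"
  shows "A * mat n n (\<lambda>(i, j). F i j) = mat n n (\<lambda>(i, j). \<Sum>l < n. A $$ (i, l) * F l j)"
  using assms by (intro eq_matI) (auto simp: scalar_prod_def atLeast0LessThan)

lemma inverse_certificate_cartan_inv:
  assumes "inverse_certificate b H K"
  shows "cartan_inv b = mat (rank b) (rank b) (\<lambda>(i, j). H i j)" (is "_ = ?H")
    and "cartan_inv b * cartan_inv b = mat (rank b) (rank b) (\<lambda>(i, j). K i j)" (is "_ = ?K")
proof -
  have CH: "cartan b * ?H = 1\<^sub>m (rank b)"
    using assms by (auto simp: mult_mat_eq[OF cartan_carrier] inverse_certificate_def intro!: eq_matI)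
  have CK: "cartan b * ?K = ?H"
    using assms by (auto simp: mult_mat_eq[OF cartan_carrier] inverse_certificate_def intro!: eq_matI)
  show inv: "cartan_inv b = ?H"
    unfolding cartan_inv_def using mat_inverse_eqI[OF cartan_carrier _ CH] by simp
  have HC: "?H * cartan b = 1\<^sub>m (rank b)"
    by (rule mat_mult_left_right_inverse[OF cartan_carrier _ CH]) simp
  \<comment> \<open>Since H C = 1 and C K = H, the two bracketings of H C K are K and H H.\<close>
  have "?H * cartan b * ?K = ?H * (cartan b * ?K)"
    by (rule assoc_mult_mat[of _ "rank b" "rank b" _ "rank b" _ "rank b"]) (simp_all add: cartan_carrier)
  then have "?K = ?H * ?H"
    unfolding HC CK by simp
  then show "cartan_inv b * cartan_inv b = ?K"
    by (simp only: inv)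
qed

lemma inverse_certificate_square:
  assumes "inverse_certificate b H K" "i < rank b" "j < rank b"
  shows "K i j = (\<Sum>l < rank b. H i l * H l j)"
proof -
  have "K i j = (cartan_inv b * cartan_inv b) $$ (i, j)"
    using assms(2,3) by (simp add: inverse_certificate_cartan_inv(2)[OF assms(1)])
  also have "\<dots> = (\<Sum>l < rank b. H i l * H l j)"
    using assms(2,3)
    by (simp add: inverse_certificate_cartan_inv(1)[OF assms(1)]
        mult_mat_eq[of _ "rank b"])
  finally show ?thesis .
qed

lemma inverse_certificate_pos:
  assumes "inverse_certificate b H K" "i < rank b" "j < rank b"
  shows "0 < H i j" "0 < K i j"
proof -
  have pos: "0 < H i j" if "i < rank b" "j < rank b" for i j
    using assms(1) that by (simp add: inverse_certificate_def)
  then show "0 < H i j" using assms by simp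
  show "0 < K i j" unfolding inverse_certificate_square[OF assms]
    using assms by (intro sum_pos) (auto intro!: mult_pos_pos pos)
qed

lemma R_max_eq:
  assumes "inverse_certificate b H K"
  shows "R_max b = Max ((\<lambda>(i, j). H i j / K i j) ` ({..<rank b} \<times> {..<rank b}))"
proof -
  have entry: "cartan_inv b $$ (i, j) / (cartan_inv b * cartan_inv b) $$ (i, j) = H i j / K i j"
    if "i < rank b" "j < rank b" for i j
    unfolding inverse_certificate_cartan_inv(2)[OF assms]
    unfolding inverse_certificate_cartan_inv(1)[OF assms] using that by simp
  have "{cartan_inv b $$ (i, j) / (cartan_inv b * cartan_inv b) $$ (i, j) | i j.
      i < rank b \<and> j < rank b} = {H i j / K i j | i j. i < rank b \<and> j < rank b}"
    by (intro Collect_cong ex_cong1) (metis entry)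
  also have "\<dots> = (\<lambda>(i, j). H i j / K i j) ` ({..<rank b} \<times> {..<rank b})"
    by (auto simp: image_iff)
  finally show ?thesis by (simp only: R_max_def)
qed

lemma le_R_max:
  assumes "inverse_certificate b H K" "i < rank b" "j < rank b"
  shows "H i j \<le> R_max b * K i j"
proof -
  have "H i j / K i j \<le> R_max b"
    unfolding R_max_eq[OF assms(1)] using assms(2,3) by (intro Max_ge) auto
  then show ?thesis using inverse_certificate_pos(2)[OF assms] by (simp add: field_simps)
qed

text \<open>The maximum over a finite nonempty index set is attained, so an entrywise strict bound
  on H / K survives it.\<close>

lemma R_max_less:
  assumes "inverse_certificate b H K" "0 < rank b" "0 < h"
    and "\<And>i j. i < rank b \<Longrightarrow> j < rank b \<Longrightarrow> h * H i j < 4 * K i j"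
  shows "R_max b < 4 / h"
proof -
  have "H i j / K i j < 4 / h" if "i < rank b" "j < rank b" for i j
    using assms(4)[OF that] inverse_certificate_pos(2)[OF assms(1) that] assms(3)
    by (simp add: field_simps)
  moreover have "{..<rank b} \<times> {..<rank b} \<noteq> {}" using assms(2) by auto
  ultimately show ?thesis
    unfolding R_max_eq[OF assms(1)] by (subst Max_less_iff) auto
qed

text \<open>Expands quantifiers over the nodes of an exceptional diagram into finite conjunctions
  that simplification can evaluate.\<close>

lemma all_less_Suc_unfold:
  "(\<forall>i < Suc n. P i) \<longleftrightarrow> (\<forall>i < n. P i) \<and> P n"
  by (auto simp: less_Suc_eq)

lemma all_less_numeral_unfold:
  "(\<forall>i < numeral m. P i) \<longleftrightarrow> (\<forall>i < pred_numeral m. P i) \<and> P (pred_numeral m)"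
  unfolding numeral_eq_Suc by (rule all_less_Suc_unfold)

lemmas all_less_unfold = all_less_Suc_unfold all_less_numeral_unfold

section \<open>Infinite series\<close>

text \<open>\<open>p\<close> and \<open>q\<close> are the negated entries left and right of the
  diagonal. They may depend on the row \<open>i\<close>, which accommodates the double bonds of
  types B and C and the missing links of type D.\<close>

lemma sum_tridiagonal:
  fixes y :: "nat \<Rightarrow> real"
  assumes "i < r"
  shows "(\<Sum>l < r. (if l = i then 2 * y l else 0) - (if Suc l = i then p * y l else 0)
            - (if l = Suc i then q * y l else 0))
       = 2 * y i - (if i = 0 then 0 else p * y (i - 1)) - (if Suc i < r then q * y (Suc i) else 0)"
proof -
  have "(\<Sum>l < r. if Suc l = i then p * y l else 0) = (if i = 0 then 0 else p * y (i - 1))"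
    using assms by (cases i) auto
  then show ?thesis using assms by (simp add: sum_subtractf)
qed

section \<open>Type A\<close>

definition inverse_A :: "nat \<Rightarrow> nat \<Rightarrow> nat \<Rightarrow> real" where
  "inverse_A h a b = real (min a b) * (real h - real (max a b)) / real h"

definition factor_A :: "nat \<Rightarrow> nat \<Rightarrow> nat \<Rightarrow> real" where
  "factor_A h a b =
     (2 * real h * real (max a b) - (real (max a b))\<^sup>2 - (real (min a b))\<^sup>2 + 1) / 6"

definition square_A :: "nat \<Rightarrow> nat \<Rightarrow> nat \<Rightarrow> real" where
  "square_A h a b = inverse_A h a b * factor_A h a b"

text \<open>Green's function of the chain 0, ..., h with zeros at both ends: as a function of the
  first position the slope is (h - b)/h before b and -b/h after it, a drop of exactly 1.\<close>

lemma second_difference_inverse_A: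
  assumes "0 < h"
  shows "2 * inverse_A h (Suc i) b - inverse_A h i b - inverse_A h (Suc (Suc i)) b
    = of_bool (Suc i = b)"
proof -
  consider "b \<le> i" | "b = Suc i" | "Suc (Suc i) \<le> b" by linarith
  then show ?thesis
    using assms by cases (auto simp: inverse_A_def min_def max_def field_simps)
qed

lemma second_difference_square_A:
  assumes "0 < h"
  shows "2 * square_A h (Suc i) b - square_A h i b - square_A h (Suc (Suc i)) b
    = inverse_A h (Suc i) b"
proof -
  consider "b \<le> i" | "b = Suc i" | "Suc (Suc i) \<le> b" by linarith
  then show ?thesis
    using assms
    by cases (auto simp: square_A_def factor_A_def inverse_A_def min_def max_def field_simps
        power2_eq_square)
qed

text \<open>Node l sits at position l + 1; fictitious zeros at positions 0 and r + 1 stand in for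
  the missing neighbours, so the end rows need no separate formula.\<close>

lemma cartan_TypeA_row:
  fixes x :: "nat \<Rightarrow> real"
  assumes "i < r" "x 0 = 0" "x (Suc r) = 0"
  shows "(\<Sum>l < r. cartan (TypeA r) $$ (i, l) * x (Suc l))
       = 2 * x (Suc i) - x i - x (Suc (Suc i))"
proof -
  have "(\<Sum>l < r. cartan (TypeA r) $$ (i, l) * x (Suc l))
      = (\<Sum>l < r. (if l = i then 2 * x (Suc l) else 0) - (if Suc l = i then 1 * x (Suc l) else 0)
            - (if l = Suc i then 1 * x (Suc l) else 0))"
    using assms(1) by (intro sum.cong) (auto simp: cartan_def adjacent_def)
  also have "\<dots> = 2 * x (Suc i) - x i - x (Suc (Suc i))"
    unfolding sum_tridiagonal[OF assms(1)]
    using assms by (cases "Suc i = r") (auto simp: gr0_conv_Suc)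
  finally show ?thesis .
qed

lemma inverse_certificate_A:
  "inverse_certificate (TypeA r) (\<lambda>i j. inverse_A (Suc r) (Suc i) (Suc j))
     (\<lambda>i j. square_A (Suc r) (Suc i) (Suc j))"
  unfolding inverse_certificate_def
proof (intro allI impI conjI)
  fix i j assume "i < rank (TypeA r)" "j < rank (TypeA r)"
  then have ij: "i < r" "j < r" by simp_all
  show "(\<Sum>l < rank (TypeA r). cartan (TypeA r) $$ (i, l) * inverse_A (Suc r) (Suc l) (Suc j))
      = of_bool (i = j)"
    using cartan_TypeA_row[of i r "\<lambda>a. inverse_A (Suc r) a (Suc j)"]
      second_difference_inverse_A[of "Suc r" i "Suc j"] ij
    by (simp add: inverse_A_def)
  show "(\<Sum>l < rank (TypeA r). cartan (TypeA r) $$ (i, l) * square_A (Suc r) (Suc l) (Suc j))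
      = inverse_A (Suc r) (Suc i) (Suc j)"
    using cartan_TypeA_row[of i r "\<lambda>a. square_A (Suc r) a (Suc j)"]
      second_difference_square_A[of "Suc r" i "Suc j"] ij
    by (simp add: square_A_def inverse_A_def)
  show "0 < inverse_A (Suc r) (Suc i) (Suc j)"
    using ij by (auto simp: inverse_A_def intro!: divide_pos_pos mult_pos_pos)
qed

lemma gap_A:
  assumes "0 < a" "a < h" "0 < b" "b < h" "2 < h"
  shows "real h * inverse_A h a b < 4 * square_A h a b"
proof -
  define p q where "p = real (min a b)" and "q = real (max a b)"
  have pq: "1 \<le> p" "p \<le> q" "q \<le> real h - 1" using assms by (auto simp: p_def q_def)
  have "p\<^sup>2 \<le> q\<^sup>2" using pq by (intro power_mono) auto
  \<comment> \<open>This says h q - q^2 >= h - 1. With p <= q the right-hand side below is then at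
    least 4 h - 2, which exceeds 3 h because h > 2; at h = 2, the case of A_1, it only equals 3
    h.\<close>
  moreover have "0 \<le> (q - 1) * (real h - 1 - q)" using pq by (intro mult_nonneg_nonneg) auto
  ultimately have "3 * real h < 2 * (2 * real h * q - q\<^sup>2 - p\<^sup>2 + 1)"
    using assms(5) by (simp add: algebra_simps power2_eq_square)
  then have "real h < 4 * factor_A h a b"
    by (simp add: factor_A_def p_def q_def)
  moreover have "0 < inverse_A h a b"
    using assms by (auto simp: inverse_A_def intro!: divide_pos_pos mult_pos_pos)
  ultimately show ?thesis
    using mult_strict_left_mono[of "real h" "4 * factor_A h a b" "inverse_A h a b"]
    by (simp add: square_A_def mult_ac)
qed

subsection \<open>Types B and C\<close>

text \<open>Both matrices come from a chain that is fixed at one end and free at the other one, with a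
  weight \<open>1/2\<close> at the free end: on the rows in type \<open>B\<close>, on the columns in type \<open>C\<close>.\<close>

definition inverse_chain :: "nat \<Rightarrow> nat \<Rightarrow> real" where
  "inverse_chain a b = real (min a b)"

text \<open>Obtained by the method of images from the doubled chain: for positions up to n,
  \<open>square_chain n a b\<close> is
  \<open>square_A (2 * n) a b + square_A (2 * n) a (2 * n - b)\<close>, just as min a b is the
  corresponding sum for \<open>inverse_A\<close>.\<close>

definition factor_chain :: "nat \<Rightarrow> nat \<Rightarrow> nat \<Rightarrow> real" where
  "factor_chain n a b =
     (1 - (real (min a b))\<^sup>2) / 6 - (real (max a b))\<^sup>2 / 2 + real n * real (max a b)"

definition square_chain :: "nat \<Rightarrow> nat \<Rightarrow> nat \<Rightarrow> real" where
  "square_chain n a b = inverse_chain a b * factor_chain n a b"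

lemma chain_zero [simp]: "inverse_chain 0 b = 0" "square_chain n 0 b = 0"
  by (simp_all add: inverse_chain_def square_chain_def)

lemma second_difference_inverse_chain:
  "2 * inverse_chain (Suc i) b - inverse_chain i b - inverse_chain (Suc (Suc i)) b
    = of_bool (Suc i = b)"
proof -
  consider "b \<le> i" | "b = Suc i" | "Suc (Suc i) \<le> b" by linarith
  then show ?thesis by cases (auto simp: inverse_chain_def min_def)
qed

lemma second_difference_square_chain:
  "2 * square_chain n (Suc i) b - square_chain n i b - square_chain n (Suc (Suc i)) b
    = inverse_chain (Suc i) b"
proof -
  consider "b \<le> i" | "b = Suc i" | "Suc (Suc i) \<le> b" by linarith
  then show ?thesis
    by cases (auto simp: square_chain_def factor_chain_def inverse_chain_def min_def max_def
        field_simps power2_eq_square)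
qed

lemma end_difference_inverse_chain:
  assumes "b \<le> Suc m"
  shows "inverse_chain (Suc m) b - inverse_chain m b = of_bool (Suc m = b)"
  using assms by (auto simp: inverse_chain_def min_def)

text \<open>For b <= m the difference is b (n - m - 1/2) on a chain of parameter n, so the slope
  condition at the free end forces n = m + 1, the length of the chain.\<close>

lemma end_difference_square_chain:
  assumes "b \<le> Suc m"
  shows "square_chain (Suc m) (Suc m) b - square_chain (Suc m) m b = inverse_chain (Suc m) b / 2"
proof -
  consider "b \<le> m" | "b = Suc m" using assms by linarith
  then show ?thesis
    by cases (auto simp: square_chain_def factor_chain_def inverse_chain_def min_def max_def
        field_simps power2_eq_square)
qed

lemma factor_chain_gt:
  assumes "0 < a" "a \<le> n" "0 < b" "b \<le> n" "2 \<le> n"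
  shows "real n < 2 * factor_chain n a b"
proof -
  define p q where "p = real (min a b)" and "q = real (max a b)"
  have pq: "1 \<le> p" "p \<le> q" "q \<le> real n" using assms by (auto simp: p_def q_def)
  have "p\<^sup>2 \<le> q\<^sup>2" using pq by (intro power_mono) auto
  moreover have "0 \<le> (q - 1) * (real n - q)" using pq by (intro mult_nonneg_nonneg) auto
  \<comment> \<open>Using p <= q and twice the product bound, twice the factor minus n is at least
    (2/3)(q - 3/2)^2 + n - 7/6, which is positive for n >= 2.\<close>
  moreover have "0 \<le> (q - 3 / 2)\<^sup>2" by simp
  moreover have "2 \<le> real n" using assms by simp
  ultimately have "real n < 2 * ((1 - p\<^sup>2) / 6 - q\<^sup>2 / 2 + real n * q)"
    by (simp add: field_simps power2_eq_square)
  then show ?thesis by (simp add: factor_chain_def p_def q_def)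
qed

text \<open>This is h H < 4 K for h = 2 n, before weights: n = r in types B and C, and n = r - 1 in
  type D.\<close>

lemma chain_gap:
  assumes "0 < a" "a \<le> n" "0 < b" "b \<le> n" "2 \<le> n"
  shows "real n * inverse_chain a b < 2 * square_chain n a b"
proof -
  have "0 < inverse_chain a b" using assms by (simp add: inverse_chain_def)
  from mult_strict_left_mono[OF factor_chain_gt[OF assms] this]
  show ?thesis by (simp add: square_chain_def mult_ac)
qed

definition end_weight :: "nat \<Rightarrow> nat \<Rightarrow> real" where
  "end_weight r i = (if Suc i < r then 1 else 1 / 2)"

lemma end_weight_pos: "0 < end_weight r i"
  by (simp add: end_weight_def)

text \<open>The weight 1/2 on the short node cancels the entry -2 in row r - 2 and reduces the
  diagonal entry of the last row to 1, leaving a first difference there.\<close>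

lemma cartan_TypeB_row:
  fixes x :: "nat \<Rightarrow> real"
  assumes "i < r" "2 \<le> r" "x 0 = 0"
  shows "(\<Sum>l < r. cartan (TypeB r) $$ (i, l) * (end_weight r l * x (Suc l)))
       = (if Suc i < r then 2 * x (Suc i) - x i - x (Suc (Suc i)) else x r - x (r - 1))"
proof -
  define y where "y l = end_weight r l * x (Suc l)" for l
  have "(\<Sum>l < r. cartan (TypeB r) $$ (i, l) * y l)
      = (\<Sum>l < r. (if l = i then 2 * y l else 0) - (if Suc l = i then 1 * y l else 0)
            - (if l = Suc i then (if Suc (Suc i) = r then 2 else 1) * y l else 0))"
    using assms(1) by (intro sum.cong) (auto simp: cartan_def adjacent_def)
  also have "\<dots> = (if Suc i < r then 2 * x (Suc i) - x i - x (Suc (Suc i)) else x r - x (r - 1))"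
    unfolding sum_tridiagonal[OF assms(1)]
    using assms by (cases i; cases "Suc i = r") (auto simp: y_def end_weight_def)
  finally show ?thesis by (simp add: y_def)
qed

text \<open>Here the -2 sits in the last row, which becomes twice a first difference. In C H this 2
  is cancelled by the weight of the last column; in C K it cancels the 1/2 of
  \<open>end_difference_square_chain\<close>.\<close>

lemma cartan_TypeC_row:
  fixes x :: "nat \<Rightarrow> real"
  assumes "i < r" "2 \<le> r" "x 0 = 0"
  shows "(\<Sum>l < r. cartan (TypeC r) $$ (i, l) * x (Suc l))
       = (if Suc i < r then 2 * x (Suc i) - x i - x (Suc (Suc i)) else 2 * (x r - x (r - 1)))"
proof -
  have "(\<Sum>l < r. cartan (TypeC r) $$ (i, l) * x (Suc l))
      = (\<Sum>l < r. (if l = i then 2 * x (Suc l) else 0)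
            - (if Suc l = i then (if Suc i = r then 2 else 1) * x (Suc l) else 0)
            - (if l = Suc i then 1 * x (Suc l) else 0))"
    using assms(1) by (intro sum.cong) (auto simp: cartan_def adjacent_def)
  also have "\<dots> = (if Suc i < r then 2 * x (Suc i) - x i - x (Suc (Suc i))
      else 2 * (x r - x (r - 1)))"
    unfolding sum_tridiagonal[OF assms(1)]
    using assms by (cases i; cases "Suc i = r") auto
  finally show ?thesis .
qed

lemma inverse_certificate_B:
  assumes "2 \<le> r"
  shows "inverse_certificate (TypeB r) (\<lambda>i j. end_weight r i * inverse_chain (Suc i) (Suc j))
     (\<lambda>i j. end_weight r i * square_chain r (Suc i) (Suc j))"
  unfolding inverse_certificate_def
proof (intro allI impI conjI)
  fix i j assume "i < rank (TypeB r)" "j < rank (TypeB r)"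
  then have ij: "i < r" "j < r" by simp_all
  obtain m where m: "r = Suc m" using assms by (cases r) auto
  show "(\<Sum>l < rank (TypeB r). cartan (TypeB r) $$ (i, l) *
      (end_weight r l * inverse_chain (Suc l) (Suc j))) = of_bool (i = j)"
    using cartan_TypeB_row[of i r "\<lambda>a. inverse_chain a (Suc j)"] assms ij
      second_difference_inverse_chain[of i "Suc j"] end_difference_inverse_chain[of "Suc j" m]
    by (auto simp: m less_Suc_eq)
  show "(\<Sum>l < rank (TypeB r). cartan (TypeB r) $$ (i, l) *
      (end_weight r l * square_chain r (Suc l) (Suc j)))
      = end_weight r i * inverse_chain (Suc i) (Suc j)"
    using cartan_TypeB_row[of i r "\<lambda>a. square_chain r a (Suc j)"] assms ij
      second_difference_square_chain[of r i "Suc j"] end_difference_square_chain[of "Suc j" m]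
    by (auto simp: m less_Suc_eq end_weight_def)
  show "0 < end_weight r i * inverse_chain (Suc i) (Suc j)"
    by (simp add: end_weight_pos inverse_chain_def)
qed

lemma inverse_certificate_C:
  assumes "2 \<le> r"
  shows "inverse_certificate (TypeC r) (\<lambda>i j. end_weight r j * inverse_chain (Suc i) (Suc j))
     (\<lambda>i j. end_weight r j * square_chain r (Suc i) (Suc j))"
  unfolding inverse_certificate_def
proof (intro allI impI conjI)
  fix i j assume "i < rank (TypeC r)" "j < rank (TypeC r)"
  then have ij: "i < r" "j < r" by simp_all
  obtain m where m: "r = Suc m" using assms by (cases r) auto
  show "(\<Sum>l < rank (TypeC r). cartan (TypeC r) $$ (i, l) *
      (end_weight r j * inverse_chain (Suc l) (Suc j))) = of_bool (i = j)"
  proof -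
    have "(\<Sum>l < rank (TypeC r). cartan (TypeC r) $$ (i, l) *
        (end_weight r j * inverse_chain (Suc l) (Suc j)))
      = end_weight r j * (\<Sum>l < r. cartan (TypeC r) $$ (i, l) * inverse_chain (Suc l) (Suc j))"
      by (simp add: sum_distrib_left mult_ac)
    also have "\<dots> = of_bool (i = j)"
      using cartan_TypeC_row[of i r "\<lambda>a. inverse_chain a (Suc j)"] assms ij
        second_difference_inverse_chain[of i "Suc j"] end_difference_inverse_chain[of "Suc j" m]
      by (auto simp: m less_Suc_eq end_weight_def)
    finally show ?thesis .
  qed
  show "(\<Sum>l < rank (TypeC r). cartan (TypeC r) $$ (i, l) *
      (end_weight r j * square_chain r (Suc l) (Suc j)))
      = end_weight r j * inverse_chain (Suc i) (Suc j)"
  proof -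
    have "(\<Sum>l < rank (TypeC r). cartan (TypeC r) $$ (i, l) *
        (end_weight r j * square_chain r (Suc l) (Suc j)))
      = end_weight r j * (\<Sum>l < r. cartan (TypeC r) $$ (i, l) * square_chain r (Suc l) (Suc j))"
      by (simp add: sum_distrib_left mult_ac)
    also have "\<dots> = end_weight r j * inverse_chain (Suc i) (Suc j)"
      using cartan_TypeC_row[of i r "\<lambda>a. square_chain r a (Suc j)"] assms ij
        second_difference_square_chain[of r i "Suc j"] end_difference_square_chain[of "Suc j" m]
      by (auto simp: m less_Suc_eq)
    finally show ?thesis .
  qed
  show "0 < end_weight r j * inverse_chain (Suc i) (Suc j)"
    by (simp add: end_weight_pos inverse_chain_def)
qed

subsection \<open>Type D\<close>

text \<open>Folding the two spinor nodes of \<open>D\<^sub>r\<close> onto each other gives a chain of length \<open>r - 1\<close>. On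
  vectors symmetric in the spinor nodes the Cartan matrix acts through this chain, with weight
  \<open>1/2\<close> for each spinor node; on the antisymmetric one (\<open>fork_sign\<close>) it acts as \<open>2\<close>.\<close>

definition fork_position :: "nat \<Rightarrow> nat \<Rightarrow> nat" where
  "fork_position r i = min (Suc i) (r - 1)"

definition fork_weight :: "nat \<Rightarrow> nat \<Rightarrow> real" where
  "fork_weight r i = (if i + 2 < r then 1 else 1 / 2)"

definition fork_sign :: "nat \<Rightarrow> nat \<Rightarrow> nat \<Rightarrow> real" where
  "fork_sign r i j = (if i + 2 < r \<or> j + 2 < r then 0 else if i = j then 1 else - 1)"

text \<open>The projector onto the antisymmetric spinor vector has entries \<plusminus>1/2, and C
  acts on it as 2; hence the coefficient 1/4 here and 1/8 in the square.\<close>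

definition inverse_D :: "nat \<Rightarrow> nat \<Rightarrow> nat \<Rightarrow> real" where
  "inverse_D r i j = fork_weight r i *
       (fork_weight r j * inverse_chain (fork_position r i) (fork_position r j))
     + fork_sign r i j / 4"

definition square_D :: "nat \<Rightarrow> nat \<Rightarrow> nat \<Rightarrow> real" where
  "square_D r i j = fork_weight r i *
       (fork_weight r j * square_chain (r - 1) (fork_position r i) (fork_position r j))
     + fork_sign r i j / 8"

text \<open>Nodes 0, ..., r - 2 form a chain and node r - 1 hangs on r - 3. The tridiagonal
  coefficients switch off the absent link between r - 2 and r - 1; the last two terms add the link
  that is really there.\<close>

lemma cartan_TypeD_row:
  fixes y :: "nat \<Rightarrow> real"
  assumes "i < r" "3 \<le> r"
  shows "(\<Sum>l < r. cartan (TypeD r) $$ (i, l) * y l)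
       = 2 * y i - (if 0 < i \<and> Suc i < r then y (i - 1) else 0)
         - (if i + 2 < r then y (Suc i) else 0)
         - (if Suc i = r then y (r - 3) else 0) - (if i + 3 = r then y (r - 1) else 0)"
proof -
  have "(\<Sum>l < r. cartan (TypeD r) $$ (i, l) * y l)
      = (\<Sum>l < r. ((if l = i then 2 * y l else 0)
            - (if Suc l = i then (if Suc i < r then 1 else 0) * y l else 0)
            - (if l = Suc i then (if i + 2 < r then 1 else 0) * y l else 0))
            - (if l = r - 3 then (if Suc i = r then y l else 0) else 0)
            - (if l = r - 1 then (if i + 3 = r then y l else 0) else 0))"
    using assms by (intro sum.cong) (auto simp: cartan_def adjacent_def)
  also have "\<dots> = (\<Sum>l < r. (if l = i then 2 * y l else 0)
            - (if Suc l = i then (if Suc i < r then 1 else 0) * y l else 0)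
            - (if l = Suc i then (if i + 2 < r then 1 else 0) * y l else 0))
         - (if Suc i = r then y (r - 3) else 0) - (if i + 3 = r then y (r - 1) else 0)"
    using assms(2) by (subst sum_subtractf, subst sum_subtractf) simp
  finally show ?thesis
    unfolding sum_tridiagonal[OF assms(1)] using assms by (cases i) auto
qed

text \<open>Row r - 3 sees both spinor nodes: their halves add up to one chain value and the
  antisymmetric parts \<open>e\<close> cancel. Each spinor row keeps its own \<open>e\<close>,
  doubled by the diagonal entry.\<close>

lemma cartan_TypeD_fork_row:
  fixes x e :: "nat \<Rightarrow> real"
  assumes "i < r" "3 \<le> r" "x 0 = 0"
    and e: "\<And>l. l + 2 < r \<Longrightarrow> e l = 0" "e (r - 1) = - e (r - 2)"
  shows "(\<Sum>l < r. cartan (TypeD r) $$ (i, l) * (fork_weight r l * x (fork_position r l) + e l))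
       = (if i + 2 < r then 2 * x (Suc i) - x i - x (Suc (Suc i))
          else x (r - 1) - x (r - 2) + 2 * e i)"
proof -
  obtain m where m: "r = Suc (Suc (Suc m))"
    using assms(2) by (metis Suc_le_D numeral_3_eq_3 Suc_le_mono)
  have em: "e l = 0" if "l < Suc m" for l using e(1)[of l] that by (simp add: m)
  have em2: "e (Suc (Suc m)) = - e (Suc m)" using e(2) by (simp add: m)
  consider "i < m" | "i = m" | "i = Suc m" | "i = Suc (Suc m)"
    using assms(1) m by linarith
  then show ?thesis
    unfolding cartan_TypeD_row[OF assms(1,2)]
    using assms(3) em em2
    by cases (cases i; auto simp: m fork_weight_def fork_position_def field_simps)+
qed

lemma inverse_certificate_D:
  assumes "3 \<le> r"
  shows "inverse_certificate (TypeD r) (inverse_D r) (square_D r)"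
  unfolding inverse_certificate_def
proof (intro allI impI conjI)
  fix i j assume "i < rank (TypeD r)" "j < rank (TypeD r)"
  then have ij: "i < r" "j < r" by simp_all
  obtain m where m: "r = Suc (Suc (Suc m))"
    using assms by (metis Suc_le_D numeral_3_eq_3 Suc_le_mono)
  let ?b = "fork_position r j" and ?c = "fork_weight r j"
  have b: "?b \<le> Suc (Suc m)" by (simp add: m fork_position_def)
  have sign: "fork_sign r l j = 0" if "l + 2 < r" for l
    using that by (simp add: fork_sign_def)
  have sign': "fork_sign r (r - 1) j = - fork_sign r (r - 2) j"
    using ij by (auto simp: fork_sign_def m)
  have eqi: "of_bool (Suc i = ?b) * ?c = of_bool (i = j)" if "i + 2 < r"
    using that ij by (auto simp: fork_position_def fork_weight_def m)
  \<comment> \<open>For a spinor column the folded delta contributes 1/2 in both spinor rows; the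
    sign term \<plusminus>1/2 completes it to 1 or 0.\<close>
  have eqe: "of_bool (Suc (Suc m) = ?b) * ?c + fork_sign r i j / 2 = of_bool (i = j)"
    if "\<not> i + 2 < r"
    using that ij by (auto simp: fork_position_def fork_weight_def fork_sign_def m)
  have pos: "fork_position r i = (if i + 2 < r then Suc i else Suc (Suc m))"
    using ij by (auto simp: fork_position_def m)
  have r: "r - 1 = Suc (Suc m)" "r - 2 = Suc m" by (simp_all add: m)
  have "(\<Sum>l < r. cartan (TypeD r) $$ (i, l) * inverse_D r l j)
      = (if i + 2 < r then 2 * (?c * inverse_chain (Suc i) ?b) - ?c * inverse_chain i ?b
           - ?c * inverse_chain (Suc (Suc i)) ?b
         else ?c * inverse_chain (r - 1) ?b - ?c * inverse_chain (r - 2) ?b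
           + 2 * (fork_sign r i j / 4))"
    unfolding inverse_D_def
    by (rule cartan_TypeD_fork_row[OF ij(1) assms, of "\<lambda>a. ?c * inverse_chain a ?b"
        "\<lambda>l. fork_sign r l j / 4"]) (simp, simp add: sign, subst sign', simp)
  also have "\<dots> = (if i + 2 < r then ?c * of_bool (Suc i = ?b)
         else ?c * of_bool (Suc (Suc m) = ?b) + fork_sign r i j / 2)"
    unfolding second_difference_inverse_chain[of i ?b, symmetric]
      end_difference_inverse_chain[OF b, symmetric] r
    by (simp add: algebra_simps)
  finally have "(\<Sum>l < r. cartan (TypeD r) $$ (i, l) * inverse_D r l j) = \<dots>" .
  then show "(\<Sum>l < rank (TypeD r). cartan (TypeD r) $$ (i, l) * inverse_D r l j)
      = of_bool (i = j)"
    using eqi eqe by (auto simp: mult_ac)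
  have "(\<Sum>l < r. cartan (TypeD r) $$ (i, l) * square_D r l j)
      = (if i + 2 < r then 2 * (?c * square_chain (r - 1) (Suc i) ?b)
           - ?c * square_chain (r - 1) i ?b - ?c * square_chain (r - 1) (Suc (Suc i)) ?b
         else ?c * square_chain (r - 1) (r - 1) ?b - ?c * square_chain (r - 1) (r - 2) ?b
           + 2 * (fork_sign r i j / 8))"
    unfolding square_D_def
    by (rule cartan_TypeD_fork_row[OF ij(1) assms, of "\<lambda>a. ?c * square_chain (r - 1) a ?b"
        "\<lambda>l. fork_sign r l j / 8"]) (simp, simp add: sign, subst sign', simp)
  also have "\<dots> = (if i + 2 < r then ?c * inverse_chain (Suc i) ?b
         else ?c * (inverse_chain (Suc (Suc m)) ?b / 2) + fork_sign r i j / 4)"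
    unfolding second_difference_square_chain[of "r - 1" i ?b, symmetric]
      end_difference_square_chain[OF b, symmetric] r
    by (simp add: algebra_simps)
  finally have "(\<Sum>l < r. cartan (TypeD r) $$ (i, l) * square_D r l j) = \<dots>" .
  then show "(\<Sum>l < rank (TypeD r). cartan (TypeD r) $$ (i, l) * square_D r l j) = inverse_D r i j"
    using pos by (auto simp: inverse_D_def fork_weight_def fork_sign_def)
  \<comment> \<open>The only entry with a negative contribution links the two different spinor
    nodes; it is (r - 2)/4.\<close>
  show "0 < inverse_D r i j"
    using ij by (auto simp: inverse_D_def fork_weight_def fork_position_def fork_sign_def
        inverse_chain_def m min_def)
qed

lemma gap_D:
  assumes "3 \<le> r" "i < r" "j < r"
  shows "real (2 * r - 2) * inverse_D r i j < 4 * square_D r i j"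
proof -
  define n where "n = r - 1"
  have n: "2 \<le> n" "r = Suc n" using assms(1) by (simp_all add: n_def)
  show ?thesis
  proof (cases "i + 2 < r \<or> j + 2 < r")
    case True
    let ?w = "fork_weight r i * fork_weight r j"
    have "0 < ?w" by (simp add: fork_weight_def)
    moreover have "real n * inverse_chain (fork_position r i) (fork_position r j)
        < 2 * square_chain n (fork_position r i) (fork_position r j)"
      using n by (intro chain_gap) (auto simp: fork_position_def)
    ultimately have lt: "?w * (real n * inverse_chain (fork_position r i) (fork_position r j))
        < ?w * (2 * square_chain n (fork_position r i) (fork_position r j))"
      by (rule mult_strict_left_mono[rotated])
    have "inverse_D r i j
        = ?w * inverse_chain (fork_position r i) (fork_position r j)"
      using True by (auto simp: inverse_D_def fork_sign_def)
    moreover have "square_D r i j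
        = ?w * square_chain n (fork_position r i) (fork_position r j)"
      using True by (auto simp: square_D_def fork_sign_def n_def)
    moreover have "real (2 * r - 2) = 2 * real n" by (simp add: n)
    ultimately show ?thesis using lt by (simp add: algebra_simps)
  next
    case False
    then have ends: "fork_position r i = n" "fork_position r j = n"
      "fork_weight r i = 1 / 2" "fork_weight r j = 1 / 2"
      using n by (auto simp: fork_position_def fork_weight_def)
    define x where "x = real n"
    have x: "2 \<le> x" using n by (simp add: x_def)
    \<comment> \<open>With X = x (x - 2)(2 x + 1), the two differences below are X + 3 (equal spinor
      nodes) and X + 6 x - 3 (different ones).\<close>
    then have "0 \<le> x * ((x - 2) * (2 * x + 1))" "0 \<le> (x - 2) * (2 * x + 1)"
      by (intro mult_nonneg_nonneg; simp)+
    then have ineq: "3 * x * (x + 1) < 2 * x ^ 3 + x + 3" "3 * x * (x - 1) < 2 * x ^ 3 + x - 3"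
      using x by (simp_all add: algebra_simps power2_eq_square power3_eq_cube)
    have h: "real (2 * r - 2) = 2 * x" by (simp add: n x_def)
    have inverse: "inverse_D r i j = (x + fork_sign r i j) / 4"
      by (simp add: inverse_D_def ends inverse_chain_def x_def)
    have square: "square_D r i j = (2 * x ^ 3 + x + 3 * fork_sign r i j) / 24"
      unfolding square_D_def ends n_def[symmetric]
      by (simp add: square_chain_def factor_chain_def inverse_chain_def x_def
          field_simps power2_eq_square power3_eq_cube)
    have "fork_sign r i j = 1 \<or> fork_sign r i j = - 1"
      using False by (auto simp: fork_sign_def)
    then show ?thesis
      unfolding h inverse square using ineq by (auto simp: field_simps)
  qed
qed

section \<open>Exceptional types\<close>

text \<open>The integer table is the adjugate of C and 3 is det C, so the square has denominator 9.
  For E7 the determinant is 2, for E8 and F4 it is 1.\<close>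

definition inverse_E6 :: "nat \<Rightarrow> nat \<Rightarrow> real" where
  "inverse_E6 i j =
     [[4, 3, 5, 6, 4, 2],
      [3, 6, 6, 9, 6, 3],
      [5, 6, 10, 12, 8, 4],
      [6, 9, 12, 18, 12, 6],
      [4, 6, 8, 12, 10, 5],
      [2, 3, 4, 6, 5, 4]] ! i ! j / 3"

definition square_E6 :: "nat \<Rightarrow> nat \<Rightarrow> real" where
  "square_E6 i j =
     [[106, 144, 200, 279, 196, 101],
      [144, 207, 279, 396, 279, 144],
      [200, 279, 385, 540, 380, 196],
      [279, 396, 540, 765, 540, 279],
      [196, 279, 380, 540, 385, 200],
      [101, 144, 196, 279, 200, 106]] ! i ! j / 9"

lemma inverse_certificate_E6: "inverse_certificate TypeE6 inverse_E6 square_E6"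
  unfolding inverse_certificate_def
  by (simp add: all_less_unfold lessThan_nat_numeral lessThan_Suc cartan_def adjacent_def
      inverse_E6_def square_E6_def)

lemma gap_E6:
  assumes "i < 6" "j < 6"
  shows "12 * inverse_E6 i j < 4 * square_E6 i j"
proof -
  have "\<forall>i < 6. \<forall>j < 6. 12 * inverse_E6 i j < 4 * square_E6 i j"
    by (simp add: all_less_unfold inverse_E6_def square_E6_def)
  then show ?thesis using assms by blast
qed

definition inverse_E7 :: "nat \<Rightarrow> nat \<Rightarrow> real" where
  "inverse_E7 i j =
     [[4, 4, 6, 8, 6, 4, 2],
      [4, 7, 8, 12, 9, 6, 3],
      [6, 8, 12, 16, 12, 8, 4],
      [8, 12, 16, 24, 18, 12, 6],
      [6, 9, 12, 18, 15, 10, 5],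
      [4, 6, 8, 12, 10, 8, 4],
      [2, 3, 4, 6, 5, 4, 3]] ! i ! j / 2"

definition square_E7 :: "nat \<Rightarrow> nat \<Rightarrow> real" where
  "square_E7 i j =
     [[188, 272, 368, 536, 416, 284, 144],
      [272, 399, 536, 784, 609, 416, 211],
      [368, 536, 724, 1056, 820, 560, 284],
      [536, 784, 1056, 1544, 1200, 820, 416],
      [416, 609, 820, 1200, 935, 640, 325],
      [284, 416, 560, 820, 640, 440, 224],
      [144, 211, 284, 416, 325, 224, 115]] ! i ! j / 4"

lemma inverse_certificate_E7: "inverse_certificate TypeE7 inverse_E7 square_E7"
  unfolding inverse_certificate_def
  by (simp add: all_less_unfold lessThan_nat_numeral lessThan_Suc cartan_def adjacent_def
      inverse_E7_def square_E7_def)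

lemma gap_E7:
  assumes "i < 7" "j < 7"
  shows "18 * inverse_E7 i j < 4 * square_E7 i j"
proof -
  have "\<forall>i < 7. \<forall>j < 7. 18 * inverse_E7 i j < 4 * square_E7 i j"
    by (simp add: all_less_unfold inverse_E7_def square_E7_def)
  then show ?thesis using assms by blast
qed

definition inverse_E8 :: "nat \<Rightarrow> nat \<Rightarrow> real" where
  "inverse_E8 i j =
     [[4, 5, 7, 10, 8, 6, 4, 2],
      [5, 8, 10, 15, 12, 9, 6, 3],
      [7, 10, 14, 20, 16, 12, 8, 4],
      [10, 15, 20, 30, 24, 18, 12, 6],
      [8, 12, 16, 24, 20, 15, 10, 5],
      [6, 9, 12, 18, 15, 12, 8, 4],
      [4, 6, 8, 12, 10, 8, 6, 3],
      [2, 3, 4, 6, 5, 4, 3, 2]] ! i ! j"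

definition square_E8 :: "nat \<Rightarrow> nat \<Rightarrow> real" where
  "square_E8 i j =
     [[310, 460, 616, 915, 744, 565, 380, 191],
      [460, 684, 915, 1360, 1106, 840, 565, 284],
      [616, 915, 1225, 1820, 1480, 1124, 756, 380],
      [915, 1360, 1820, 2705, 2200, 1671, 1124, 565],
      [744, 1106, 1480, 2200, 1790, 1360, 915, 460],
      [565, 840, 1124, 1671, 1360, 1034, 696, 350],
      [380, 565, 756, 1124, 915, 696, 469, 236],
      [191, 284, 380, 565, 460, 350, 236, 119]] ! i ! j"

lemma inverse_certificate_E8: "inverse_certificate TypeE8 inverse_E8 square_E8"
  unfolding inverse_certificate_def
  by (simp add: all_less_unfold lessThan_nat_numeral lessThan_Suc cartan_def adjacent_def
      inverse_E8_def square_E8_def)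

lemma gap_E8:
  assumes "i < 8" "j < 8"
  shows "30 * inverse_E8 i j < 4 * square_E8 i j"
proof -
  have "\<forall>i < 8. \<forall>j < 8. 30 * inverse_E8 i j < 4 * square_E8 i j"
    by (simp add: all_less_unfold inverse_E8_def square_E8_def)
  then show ?thesis using assms by blast
qed

text \<open>Not symmetric, as C is not: the table becomes symmetric once the rows 2 and 3 of the
  short roots are doubled, that is, after multiplication by D.\<close>

definition inverse_F4 :: "nat \<Rightarrow> nat \<Rightarrow> real" where
  "inverse_F4 i j =
     [[2, 3, 4, 2],
      [3, 6, 8, 4],
      [2, 4, 6, 3],
      [1, 2, 3, 2]] ! i ! j"

definition square_F4 :: "nat \<Rightarrow> nat \<Rightarrow> real" where
  "square_F4 i j =
     [[23, 44, 62, 32],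
      [44, 85, 120, 62],
      [31, 60, 85, 44],
      [16, 31, 44, 23]] ! i ! j"

lemma inverse_certificate_F4: "inverse_certificate TypeF4 inverse_F4 square_F4"
  unfolding inverse_certificate_def
  by (simp add: all_less_unfold lessThan_nat_numeral lessThan_Suc cartan_def adjacent_def
      inverse_F4_def square_F4_def)

lemma gap_F4:
  assumes "i < 4" "j < 4"
  shows "9 * inverse_F4 i j < 4 * square_F4 i j"
proof -
  have "\<forall>i < 4. \<forall>j < 4. 9 * inverse_F4 i j < 4 * square_F4 i j"
    by (simp add: all_less_unfold inverse_F4_def square_F4_def)
  then show ?thesis using assms by blast
qed

section \<open>The bound on \<open>R_max\<close>\<close>

lemma R_max_A_less:
  assumes "2 \<le> r"
  shows "R_max (TypeA r) < 4 / real (Suc r)"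
proof (rule R_max_less[OF inverse_certificate_A])
  fix i j assume "i < rank (TypeA r)" "j < rank (TypeA r)"
  then show "real (Suc r) * inverse_A (Suc r) (Suc i) (Suc j)
      < 4 * square_A (Suc r) (Suc i) (Suc j)"
    using assms by (intro gap_A) auto
qed (use assms in auto)

lemma R_max_B_less:
  assumes "2 \<le> r"
  shows "R_max (TypeB r) < 4 / (2 * real r)"
proof (rule R_max_less[OF inverse_certificate_B[OF assms]])
  fix i j assume "i < rank (TypeB r)" "j < rank (TypeB r)"
  then have "real r * inverse_chain (Suc i) (Suc j) < 2 * square_chain r (Suc i) (Suc j)"
    using assms by (intro chain_gap) auto
  then show "2 * real r * (end_weight r i * inverse_chain (Suc i) (Suc j))
      < 4 * (end_weight r i * square_chain r (Suc i) (Suc j))"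
    by (simp add: end_weight_def)
qed (use assms in auto)

lemma R_max_C_less:
  assumes "2 \<le> r"
  shows "R_max (TypeC r) < 4 / (2 * real r)"
proof (rule R_max_less[OF inverse_certificate_C[OF assms]])
  fix i j assume "i < rank (TypeC r)" "j < rank (TypeC r)"
  then have "real r * inverse_chain (Suc i) (Suc j) < 2 * square_chain r (Suc i) (Suc j)"
    using assms by (intro chain_gap) auto
  then show "2 * real r * (end_weight r j * inverse_chain (Suc i) (Suc j))
      < 4 * (end_weight r j * square_chain r (Suc i) (Suc j))"
    by (simp add: end_weight_def)
qed (use assms in auto)

lemma R_max_less_dual_coxeter:
  assumes "simple_type b" "b \<noteq> TypeA 1"
  shows "R_max b < 4 / real (dual_coxeter b)"
proof (cases b)
  case (TypeA r)
  then show ?thesis using assms R_max_A_less[of r] by auto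
next
  case (TypeB r)
  have "4 / (2 * real r) \<le> 4 / real (2 * r - 1)"
    using TypeB assms(1) by (intro divide_left_mono) auto
  then show ?thesis using TypeB assms R_max_B_less[of r] by simp
next
  case (TypeC r)
  have "4 / (2 * real r) \<le> 4 / real (r + 1)"
    using TypeC assms(1) by (intro divide_left_mono) auto
  then show ?thesis using TypeC assms R_max_C_less[of r] by simp
next
  case (TypeD r)
  then have r: "3 \<le> r" using assms by simp
  show ?thesis unfolding TypeD dual_coxeter.simps
    using r gap_D[OF r] by (intro R_max_less[OF inverse_certificate_D[OF r]]) auto
next
  case TypeE6
  show ?thesis unfolding TypeE6 using gap_E6
    by (intro R_max_less[OF inverse_certificate_E6]) auto
next
  case TypeE7
  show ?thesis unfolding TypeE7 using gap_E7
    by (intro R_max_less[OF inverse_certificate_E7]) auto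
next
  case TypeE8
  show ?thesis unfolding TypeE8 using gap_E8
    by (intro R_max_less[OF inverse_certificate_E8]) auto
next
  case TypeF4
  show ?thesis unfolding TypeF4 using gap_F4
    by (intro R_max_less[OF inverse_certificate_F4]) auto
qed

lemma inverse_certificate_exists:
  assumes "simple_type b"
  obtains H K where "inverse_certificate b H K"
proof (cases b)
  case (TypeA r)
  show ?thesis using that[OF inverse_certificate_A[of r, folded TypeA]] .
next
  case (TypeB r)
  then show ?thesis using assms that[of _ _] inverse_certificate_B[of r] by auto
next
  case (TypeC r)
  then show ?thesis using assms that[of _ _] inverse_certificate_C[of r] by auto
next
  case (TypeD r)
  then show ?thesis using assms that[of _ _] inverse_certificate_D[of r] by auto
next
  case TypeE6
  show ?thesis using that[OF inverse_certificate_E6[folded TypeE6]] .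
next
  case TypeE7
  show ?thesis using that[OF inverse_certificate_E7[folded TypeE7]] .
next
  case TypeE8
  show ?thesis using that[OF inverse_certificate_E8[folded TypeE8]] .
next
  case TypeF4
  show ?thesis using that[OF inverse_certificate_F4[folded TypeF4]] .
qed

section \<open>The large-N limit\<close>

lemma d_pos: "0 < d x"
  by (cases x) auto

section \<open>Symmetry of D C and the comparison of Q with P\<close>

lemma DC_symmetric_entry:
  assumes "gauge_assignment b g" "i < rank b" "j < rank b"
  shows "d (g i) * cartan b $$ (i, j) = d (g j) * cartan b $$ (j, i)"
proof -
  have entry: "(D_mat b g * cartan b) $$ (i, j) = d (g i) * cartan b $$ (i, j)"
    if "i < rank b" "j < rank b" for i j
  proof -
    have "(D_mat b g * cartan b) $$ (i, j)
        = (\<Sum>l < rank b. (if i = l then d (g i) else 0) * cartan b $$ (l, j))"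
      using that by (simp add: D_mat_def cartan_def scalar_prod_def atLeast0LessThan)
    also have "\<dots> = (\<Sum>l < rank b. if i = l then d (g i) * cartan b $$ (l, j) else 0)"
      by (intro sum.cong) auto
    finally show ?thesis using that by simp
  qed
  have "(D_mat b g * cartan b) $$ (i, j) = transpose_mat (D_mat b g * cartan b) $$ (i, j)"
    by (simp only: DC_symmetric[OF assms(1)])
  also have "\<dots> = (D_mat b g * cartan b) $$ (j, i)"
    using assms(2,3) by (intro index_transpose_mat(1)) (simp_all add: D_mat_def cartan_def)
  finally show ?thesis by (simp add: entry assms(2,3))
qed

text \<open>With \<phi> = C v and w = C^-1 v, symmetry of D C rewrites v^T D v as \<phi>^T D w. Both
  sides then pair the same nonnegative weights d_i \<phi>_i with v_i and w_i, so it suffices that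
  v_i <= R w_i.\<close>

lemma quadratic_form_le_R_max:
  fixes v :: "nat \<Rightarrow> real"
  assumes cert: "inverse_certificate b H K" and g: "gauge_assignment b g"
    and nonneg: "\<And>i. i < rank b \<Longrightarrow> 0 \<le> (\<Sum>j < rank b. cartan b $$ (i, j) * v j)"
  shows "(\<Sum>i < rank b. d (g i) * v i * (\<Sum>j < rank b. cartan b $$ (i, j) * v j))
       \<le> R_max b * (\<Sum>i < rank b. d (g i) * (v i)\<^sup>2)"
proof -
  let ?r = "rank b"
  define \<phi> where "\<phi> i = (\<Sum>j < ?r. cartan b $$ (i, j) * v j)" for i
  define w where "w i = (\<Sum>j < ?r. H i j * v j)" for i
  have swap: "(\<Sum>j < ?r. M i j * (\<Sum>l < ?r. N j l * u l))
      = (\<Sum>l < ?r. (\<Sum>j < ?r. M i j * N j l) * u l)" for M N :: "nat \<Rightarrow> nat \<Rightarrow> real" and u i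
    unfolding sum_distrib_left sum_distrib_right
    by (subst sum.swap) (simp add: mult_ac)
  have CH: "(\<Sum>l < ?r. cartan b $$ (i, l) * H l j) = of_bool (i = j)"
    if "i < ?r" "j < ?r" for i j
    using cert that by (simp add: inverse_certificate_def)
  have delta: "(\<Sum>l < ?r. of_bool (i = l) * v l) = v i" if "i < ?r" for i
  proof -
    have "(\<Sum>l < ?r. of_bool (i = l) * v l) = (\<Sum>l < ?r. if i = l then v l else 0)"
      by (intro sum.cong) auto
    then show ?thesis using that by simp
  qed
  have Cw: "(\<Sum>j < ?r. cartan b $$ (i, j) * w j) = v i" if "i < ?r" for i
  proof -
    have "(\<Sum>j < ?r. cartan b $$ (i, j) * w j)
        = (\<Sum>l < ?r. (\<Sum>j < ?r. cartan b $$ (i, j) * H j l) * v l)"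
      unfolding w_def by (rule swap)
    also have "\<dots> = (\<Sum>l < ?r. of_bool (i = l) * v l)"
      using CH that by (intro sum.cong) auto
    finally show ?thesis using delta that by simp
  qed
  have HC: "(\<Sum>l < ?r. H i l * cartan b $$ (l, j)) = of_bool (i = j)"
    if "i < ?r" "j < ?r" for i j
  proof -
    let ?H = "mat ?r ?r (\<lambda>(i, j). H i j)"
    have "cartan b * ?H = 1\<^sub>m ?r"
      using CH by (auto simp: mult_mat_eq[OF cartan_carrier] intro!: eq_matI)
    then have "?H * cartan b = 1\<^sub>m ?r"
      by (intro mat_mult_left_right_inverse[OF cartan_carrier]) simp_all
    then have "(?H * cartan b) $$ (i, j) = (1\<^sub>m ?r) $$ (i, j)" by simp
    then show ?thesis
      using that by (simp add: scalar_prod_def cartan_def atLeast0LessThan)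
  qed
  have v: "v i = (\<Sum>j < ?r. H i j * \<phi> j)" if "i < ?r" for i
  proof -
    have "(\<Sum>j < ?r. H i j * \<phi> j)
        = (\<Sum>l < ?r. (\<Sum>j < ?r. H i j * cartan b $$ (j, l)) * v l)"
      unfolding \<phi>_def by (rule swap)
    also have "\<dots> = (\<Sum>l < ?r. of_bool (i = l) * v l)"
      using HC that by (intro sum.cong) auto
    finally show ?thesis using delta that by simp
  qed
  have w: "w i = (\<Sum>j < ?r. K i j * \<phi> j)" if "i < ?r" for i
  proof -
    have "w i = (\<Sum>j < ?r. H i j * (\<Sum>l < ?r. H j l * \<phi> l))"
      unfolding w_def using v by (intro sum.cong) auto
    also have "\<dots> = (\<Sum>l < ?r. (\<Sum>j < ?r. H i j * H j l) * \<phi> l)"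
      by (rule swap)
    also have "\<dots> = (\<Sum>l < ?r. K i l * \<phi> l)"
      using that by (intro sum.cong) (simp_all add: inverse_certificate_square[OF cert])
    finally show ?thesis .
  qed
  have "(\<Sum>i < ?r. d (g i) * (v i)\<^sup>2)
      = (\<Sum>i < ?r. d (g i) * v i * (\<Sum>j < ?r. cartan b $$ (i, j) * w j))"
    using Cw by (intro sum.cong) (auto simp: power2_eq_square)
  also have "\<dots> = (\<Sum>i < ?r. \<Sum>j < ?r. (d (g i) * cartan b $$ (i, j)) * v i * w j)"
    by (simp add: sum_distrib_left mult_ac)
  \<comment> \<open>Symmetry of D C transfers C from w to v.\<close>
  also have "\<dots> = (\<Sum>i < ?r. \<Sum>j < ?r. (d (g j) * cartan b $$ (j, i)) * v i * w j)"
    by (intro sum.cong refl) (simp add: DC_symmetric_entry[OF g])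
  also have "\<dots> = (\<Sum>j < ?r. \<Sum>i < ?r. (d (g j) * cartan b $$ (j, i)) * v i * w j)"
    by (rule sum.swap)
  also have "\<dots> = (\<Sum>j < ?r. d (g j) * \<phi> j * w j)"
    by (simp add: \<phi>_def sum_distrib_left sum_distrib_right mult_ac)
  finally have P: "(\<Sum>i < ?r. d (g i) * (v i)\<^sup>2) = (\<Sum>j < ?r. d (g j) * \<phi> j * w j)" .
  have "d (g i) * v i * \<phi> i \<le> R_max b * (d (g i) * \<phi> i * w i)" if i: "i < ?r" for i
  proof -
    \<comment> \<open>Since v = H \<phi> and w = K \<phi> with \<phi> >= 0, the entrywise bound H <=
      R K can be summed.\<close>
    have "v i \<le> R_max b * w i"
      unfolding v[OF i] w[OF i] sum_distrib_left mult.assoc[symmetric]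
      using le_R_max[OF cert i] nonneg
      by (intro sum_mono mult_right_mono) (auto simp: \<phi>_def)
    moreover have "0 \<le> d (g i) * \<phi> i"
      using d_pos[of "g i"] nonneg[OF i] by (simp add: \<phi>_def)
    ultimately have "d (g i) * \<phi> i * v i \<le> d (g i) * \<phi> i * (R_max b * w i)"
      by (rule mult_left_mono)
    then show ?thesis by (simp add: mult_ac)
  qed
  then show ?thesis
    unfolding P \<phi>_def[symmetric] sum_distrib_left by (intro sum_mono) auto
qed

text \<open>As B = D (2 - C), conformality turns (B k)_i into d_i (2 k_i - f_i + 4 S_i); the flavour
  hypermultiplets then reverse the sign of f_i.\<close>

lemma n_H_conformal:
  assumes "conformal b g k f"
  shows "n_H b g k f
       = (\<Sum>i < rank b. d (g i) * real (k i) * (2 * real (k i) + real (f i) + 4 * S (g i))) / 4"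
proof -
  let ?r = "rank b"
  have B: "B_mat b g $$ (i, j) = d (g i) * ((if i = j then 2 else 0) - cartan b $$ (i, j))"
    if "i < ?r" "j < ?r" for i j
  proof -
    have "B_mat b g $$ (i, j)
        = (\<Sum>l < ?r. (if i = l then d (g i) else 0) * A_mat b $$ (l, j))"
      using that by (simp add: B_mat_def A_mat_def D_mat_def cartan_def scalar_prod_def
          atLeast0LessThan)
    also have "\<dots> = (\<Sum>l < ?r. if i = l then d (g i) * A_mat b $$ (l, j) else 0)"
      by (intro sum.cong) auto
    also have "\<dots> = d (g i) * A_mat b $$ (i, j)" using that by simp
    finally show ?thesis
      using that by (simp add: A_mat_def cartan_def)
  qed
  have row: "(\<Sum>j < ?r. B_mat b g $$ (i, j) * real (k i) * real (k j))
      = d (g i) * real (k i) * (2 * real (k i) - (real (f i) - 4 * S (g i)))" if i: "i < ?r" for i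
  proof -
    have "(\<Sum>j < ?r. B_mat b g $$ (i, j) * real (k i) * real (k j))
        = (\<Sum>j < ?r. d (g i) * real (k i) * ((if i = j then 2 * real (k j) else 0)
              - cartan b $$ (i, j) * real (k j)))"
      using i by (intro sum.cong) (auto simp: B algebra_simps)
    also have "\<dots> = d (g i) * real (k i) * (2 * real (k i)
        - (\<Sum>j < ?r. cartan b $$ (i, j) * real (k j)))"
      unfolding sum_distrib_left[symmetric] sum_subtractf using i by simp
    finally show ?thesis
      using assms i by (simp add: conformal_def)
  qed
  have "n_H b g k f = (\<Sum>i < ?r. (\<Sum>j < ?r. B_mat b g $$ (i, j) * real (k i) * real (k j)) / 4
      + d (g i) * real (k i) * real (f i) / 2)"
    by (simp only: n_H_def sum_divide_distrib sum.distrib)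
  also have "\<dots> = (\<Sum>i < ?r. d (g i) * real (k i) * (2 * real (k i) + real (f i) + 4 * S (g i)) / 4)"
    by (intro sum.cong refl, subst row) (simp_all add: field_simps)
  finally show ?thesis by (simp only: sum_divide_distrib)
qed

section \<open>The rates at finite N and at leading order\<close>

lemma dim_gauge_nonneg: "0 < k \<Longrightarrow> 0 \<le> dim_gauge x k"
  by (cases x) (auto simp: one_le_power)

lemma \<kappa>_eq_\<kappa>_min:
  assumes "conformal b g k f" "i < rank b"
  shows "\<kappa> b g k f i = \<kappa>_min b g k f * sqrt (n_V b g k / dim_gauge (g i) (k i))"
proof (cases "n_V b g k = 0")
  \<comment> \<open>Every gauge factor is then su(1) or so(1), and both sides vanish by the
    convention x / 0 = 0.\<close>
  case True
  moreover have "\<forall>j \<in> {..<rank b}. 0 \<le> dim_gauge (g j) (k j)"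
    using assms(1) by (auto simp: conformal_def intro!: dim_gauge_nonneg)
  ultimately have "dim_gauge (g i) (k i) = 0"
    using assms(2) sum_nonneg_eq_0_iff[of "{..<rank b}" "\<lambda>j. dim_gauge (g j) (k j)"]
    by (simp add: n_V_def)
  then show ?thesis by (simp add: \<kappa>_def)
next
  case False
  then show ?thesis
    by (simp add: \<kappa>_def \<kappa>_min_def real_sqrt_mult[symmetric])
qed

text \<open>The leading term is d k^2 / 2 in all three cases: k^2 for su, k^2 / 2 for so and
  usp.\<close>

lemma dim_gauge_asymptotic:
  fixes k :: "nat \<Rightarrow> nat" and N :: "nat \<Rightarrow> real"
  assumes N: "filterlim N at_top sequentially" and k: "(\<lambda>n. real (k n) / N n) \<longlonglongrightarrow> \<nu>"
  shows "(\<lambda>n. dim_gauge x (k n) / (N n)\<^sup>2) \<longlonglongrightarrow> d x * \<nu>\<^sup>2 / 2"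
proof -
  have inv: "(\<lambda>n. 1 / N n) \<longlonglongrightarrow> 0"
    using tendsto_divide_0[OF tendsto_const filterlim_at_top_imp_at_infinity[OF N]] .
  show ?thesis
  proof (cases x)
    case SU
    have "(\<lambda>n. (real (k n) / N n)\<^sup>2 - (1 / N n)\<^sup>2) \<longlonglongrightarrow> \<nu>\<^sup>2 - 0\<^sup>2"
      by (intro tendsto_intros k inv)
    then show ?thesis by (simp add: SU power_divide diff_divide_distrib)
  next
    case SO
    have "(\<lambda>n. (real (k n) / N n) * (real (k n) / N n - 1 / N n) / 2) \<longlonglongrightarrow> \<nu> * (\<nu> - 0) / 2"
      by (intro tendsto_intros k inv) simp
    then show ?thesis by (simp add: SO power2_eq_square diff_divide_distrib[symmetric] mult_ac)
  next
    case USp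
    have "(\<lambda>n. (real (k n) / N n) * (real (k n) / N n + 1 / N n) / 2) \<longlonglongrightarrow> \<nu> * (\<nu> + 0) / 2"
      by (intro tendsto_intros k inv) simp
    then show ?thesis by (simp add: USp power2_eq_square add_divide_distrib[symmetric] mult_ac)
  qed
qed

lemma \<kappa>_min_limit:
  assumes "simple_type b" "gauge_assignment b g" "large_N_family b g N k f"
  shows "\<exists>L. (\<lambda>n. \<kappa>_min b g (k n) (f n)) \<longlonglongrightarrow> L \<and> L \<le> sqrt (1 / 2 + R_max b / 12)"
proof -
  let ?r = "rank b"
  obtain H K where cert: "inverse_certificate b H K"
    using inverse_certificate_exists[OF assms(1)] .
  have conf: "conformal b g (k n) (f n)" for n
    using assms(3) by (simp add: large_N_family_def)
  have N: "filterlim N at_top sequentially"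
    using assms(3) by (simp add: large_N_family_def)
  have "\<forall>i. \<exists>\<nu>. i < ?r \<longrightarrow> 0 < \<nu> \<and> (\<lambda>n. real (k n i) / N n) \<longlonglongrightarrow> \<nu>"
    using assms(3) by (auto simp: large_N_family_def)
  then obtain \<nu> where \<nu>: "0 < \<nu> i" "(\<lambda>n. real (k n i) / N n) \<longlonglongrightarrow> \<nu> i" if "i < ?r" for i
    by metis
  have inv: "(\<lambda>n. 1 / N n) \<longlonglongrightarrow> 0"
    using tendsto_divide_0[OF tendsto_const filterlim_at_top_imp_at_infinity[OF N]] .
  have Npos: "eventually (\<lambda>n. 0 < N n) sequentially"
    using N by (simp add: filterlim_at_top_dense)
  define \<phi> where "\<phi> i = (\<Sum>j < ?r. cartan b $$ (i, j) * \<nu> j)" for i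
  have f: "(\<lambda>n. real (f n i) / N n) \<longlonglongrightarrow> \<phi> i" if i: "i < ?r" for i
  proof -
    have "(\<lambda>n. (\<Sum>j < ?r. cartan b $$ (i, j) * (real (k n j) / N n)) + 4 * S (g i) * (1 / N n))
        \<longlonglongrightarrow> \<phi> i + 4 * S (g i) * 0"
      unfolding \<phi>_def using \<nu>(2) by (intro tendsto_intros inv) auto
    moreover have "(\<Sum>j < ?r. cartan b $$ (i, j) * (real (k n j) / N n)) + 4 * S (g i) * (1 / N n)
        = real (f n i) / N n" for n
    proof -
      have "(\<Sum>j < ?r. cartan b $$ (i, j) * real (k n j)) = real (f n i) - 4 * S (g i)"
        using conf[of n] i by (simp add: conformal_def)
      then have "(\<Sum>j < ?r. cartan b $$ (i, j) * real (k n j)) / N n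
          = (real (f n i) - 4 * S (g i)) / N n" by simp
      then show ?thesis by (simp add: sum_divide_distrib diff_divide_distrib)
    qed
    ultimately show ?thesis by simp
  qed
  \<comment> \<open>Flavour numbers are nonnegative and the shift 4 S is lost in the limit, so
    \<phi> is nonnegative although C k itself can have negative entries.\<close>
  have \<phi>_nonneg: "0 \<le> \<phi> i" if "i < ?r" for i
    using f[OF that]
    by (rule tendsto_lowerbound) (use Npos in \<open>auto elim!: eventually_mono\<close>)
  define P where "P = (\<Sum>i < ?r. d (g i) * (\<nu> i)\<^sup>2)"
  define Q where "Q = (\<Sum>i < ?r. d (g i) * \<nu> i * \<phi> i)"
  have "0 < ?r" using assms(1) by (cases b) auto
  then have P: "0 < P"
    unfolding P_def using \<nu>(1) by (intro sum_pos) (auto intro!: mult_pos_pos d_pos zero_less_power)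
  have QP: "Q \<le> R_max b * P"
    unfolding Q_def P_def \<phi>_def
    by (rule quadratic_form_le_R_max[OF cert assms(2)]) (use \<phi>_nonneg in \<open>simp add: \<phi>_def\<close>)
  have V: "(\<lambda>n. n_V b g (k n) / (N n)\<^sup>2) \<longlonglongrightarrow> P / 2"
    unfolding n_V_def P_def sum_divide_distrib
    using dim_gauge_asymptotic[OF N \<nu>(2)] by (intro tendsto_sum) auto
  have HN: "(\<lambda>n. n_H b g (k n) (f n) / (N n)\<^sup>2) \<longlonglongrightarrow> (2 * P + Q) / 4"
  proof -
    have "(\<lambda>n. (\<Sum>i < ?r. d (g i) * (real (k n i) / N n) *
          (2 * (real (k n i) / N n) + real (f n i) / N n + 4 * S (g i) * (1 / N n))) / 4)
        \<longlonglongrightarrow> (\<Sum>i < ?r. d (g i) * \<nu> i * (2 * \<nu> i + \<phi> i + 4 * S (g i) * 0)) / 4"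
      by (intro tendsto_intros inv \<nu>(2) f) auto
    moreover have "(\<Sum>i < ?r. d (g i) * \<nu> i * (2 * \<nu> i + \<phi> i + 4 * S (g i) * 0)) = 2 * P + Q"
      by (simp add: P_def Q_def sum_distrib_left sum.distrib[symmetric] algebra_simps
          power2_eq_square)
    moreover have "(\<Sum>i < ?r. d (g i) * (real (k n i) / N n) *
          (2 * (real (k n i) / N n) + real (f n i) / N n + 4 * S (g i) * (1 / N n))) / 4
        = n_H b g (k n) (f n) / (N n)\<^sup>2" for n
      unfolding n_H_conformal[OF conf]
      by (simp add: sum_divide_distrib power2_eq_square add_divide_distrib algebra_simps)
    ultimately show ?thesis by simp
  qed
  have "(\<lambda>n. (n_V b g (k n) / (N n)\<^sup>2 / 3 + n_H b g (k n) (f n) / (N n)\<^sup>2 / 6)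
        / (n_V b g (k n) / (N n)\<^sup>2)) \<longlonglongrightarrow> (P / 2 / 3 + (2 * P + Q) / 4 / 6) / (P / 2)"
    using P by (intro tendsto_intros V HN) auto
  \<comment> \<open>N n may be zero or negative at first; the factor 1/N^2 cancels only once it is
    positive.\<close>
  moreover have "eventually (\<lambda>n.
      (n_V b g (k n) / (N n)\<^sup>2 / 3 + n_H b g (k n) (f n) / (N n)\<^sup>2 / 6) / (n_V b g (k n) / (N n)\<^sup>2)
      = 2 * central_charge b g (k n) (f n) / n_V b g (k n)) sequentially"
    using Npos
  proof eventually_elim
    case (elim n)
    have "n_V b g (k n) / (N n)\<^sup>2 / 3 + n_H b g (k n) (f n) / (N n)\<^sup>2 / 6
        = 2 * central_charge b g (k n) (f n) / (N n)\<^sup>2"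
      by (simp add: central_charge_def add_divide_distrib)
    then show ?case using elim by simp
  qed
  ultimately have "(\<lambda>n. 2 * central_charge b g (k n) (f n) / n_V b g (k n))
      \<longlonglongrightarrow> (P / 2 / 3 + (2 * P + Q) / 4 / 6) / (P / 2)"
    by (rule Lim_transform_eventually)
  \<comment> \<open>The numerator is P/4 + Q/24: vector multiplets and the P-part of the
    hypermultiplets together give 1/2.\<close>
  moreover have "(P / 2 / 3 + (2 * P + Q) / 4 / 6) / (P / 2) = 1 / 2 + Q / P / 12"
    using P by (simp add: field_simps)
  ultimately have "(\<lambda>n. \<kappa>_min b g (k n) (f n)) \<longlonglongrightarrow> sqrt (1 / 2 + Q / P / 12)"
    unfolding \<kappa>_min_def by (simp add: tendsto_real_sqrt)
  moreover have "Q / P \<le> R_max b" using QP P by (simp add: field_simps)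
  ultimately show ?thesis by (intro exI[of _ "sqrt (1 / 2 + Q / P / 12)"]) simp
qed

text \<open>Leading order means that the bound concerns the limit of the minimal rate; the relation
  between the rates is exact for every member of the family.\<close>

theorem mainTheorem4:
  fixes b :: dynkin and g :: "nat \<Rightarrow> gauge" and N :: "nat \<Rightarrow> real"
    and k f :: "nat \<Rightarrow> nat \<Rightarrow> nat"
  assumes "simple_type b"
    and "gauge_assignment b g"
    and "large_N_family b g N k f"
  shows "(\<forall>n. \<forall>i < rank b.
            \<kappa> b g (k n) (f n) i
              = \<kappa>_min b g (k n) (f n) * sqrt (n_V b g (k n) / dim_gauge (g i) (k n i))) \<and>
         (\<exists>L. (\<lambda>n. \<kappa>_min b g (k n) (f n)) \<longlonglongrightarrow> L \<and>
            L \<le> sqrt (1 / 2 + R_max b / 12)) \<and>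
         (b \<noteq> TypeA 1 \<longrightarrow>
            sqrt (1 / 2 + R_max b / 12) < sqrt (1 / 2 + 1 / (3 * real (dual_coxeter b))))"
proof (intro conjI impI)
  have conf: "conformal b g (k n) (f n)" for n
    using assms(3) by (simp add: large_N_family_def)
  show "\<forall>n. \<forall>i < rank b. \<kappa> b g (k n) (f n) i
      = \<kappa>_min b g (k n) (f n) * sqrt (n_V b g (k n) / dim_gauge (g i) (k n i))"
    using \<kappa>_eq_\<kappa>_min[OF conf] by blast
  show "\<exists>L. (\<lambda>n. \<kappa>_min b g (k n) (f n)) \<longlonglongrightarrow> L \<and> L \<le> sqrt (1 / 2 + R_max b / 12)"
    by (rule \<kappa>_min_limit[OF assms])
  assume "b \<noteq> TypeA 1"
  from R_max_less_dual_coxeter[OF assms(1) this]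
  show "sqrt (1 / 2 + R_max b / 12) < sqrt (1 / 2 + 1 / (3 * real (dual_coxeter b)))"
    by simp
qed

end
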